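(* For the class of finite connected (unweighted) graphs satisfying $CD(0,\infty)$ with respect to the non-normalized Laplacian, the concepts of $k$-way expanders for all $k\ge2$ are equivalent. That is, if $\{G_m=(V_m,E_m)\}_{m\in\mathbb{N}}$ is a sequence of finite connected unweighted graphs such that each $(G_m,\mathbf{1}_{V_m})$ satisfies $CD(0,\infty)$, then for any natural numbers $k,l\ge2$, $\{G_m\}$ is a sequence of $k$-way expanders if and only if it is a sequence of $l$-way expanders.
   Context: For a finite connected unweighted graph $G=(V,E)$ (all edge weights equal to $1$) with vertex measure $\mathbf{1}_V$ (i.e. $\mu(x)=1$ for all $x\in V$), the non-normalized Laplacian is $\Delta f(x)=\sum_{y,y\sim x}(f(y)-f(x))$ for $f:V\to\mathbb{R}$. Define $\Gamma(f,g):=\frac12\{\Delta(fg)-f\Delta g-g\Delta f\}$, $\Gamma_2(f,g):=\frac12\{\Delta\Gamma(f,g)-\Gamma(f,\Delta g)-\Gamma(g,\Delta f)\}$, and $\Gamma_2(f):=\Gamma_2(f,f)$. $(G,\mathbf{1}_V)$ satisfies $CD(0,\infty)$ if $\Gamma_2(f)(x)\ge 0$ for all $f:V\to\mathbb{R}$ and all $x\in V$. $d_G$ denotes the maximal vertex degree of $G$. For a natural number $k$ define $$\mathfrak{h}_k(G):=\min_{S_1,\ldots,S_k}\max_{1\le i\le k}\frac{|E(S_i,V\setminus S_i)|}{|S_i|},$$ where the minimum is over all partitions $V=\bigsqcup_{i=1}^kS_i$ with $S_i\ne\emptyset$ for all $i$, and $|E(S,V\setminus S)|$ is the number of edges between $S$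 and $V\setminus S$. If $|V|<k$ (no such partition exists) we set $\mathfrak{h}_k(G)=+\infty$. For $k\ge2$, a sequence of finite graphs $\{G_m=(V_m,E_m)\}_{m\in\mathbb{N}}$ is a sequence of $k$-way expanders if (i) $\sup_m d_{G_m}<\infty$; (ii) $\lim_{m\to\infty}|V_m|=\infty$; (iii) $\inf_m\mathfrak{h}_k(G_m)>0$. *)

theory Defs
  imports
    Complex_Main
    "HOL-Library.Disjoint_Sets"
    "HOL-Library.Extended_Nat"
    "HOL-Library.Extended_Real"
    "Graph_Theory.Digraph_Component"
begin

text \<open>
  A finite simple graph is a \<^locale>\<open>pair_graph\<close>: a finite loop-free symmetric digraph without
  parallel arcs, in which an undirected edge between \<open>x\<close> and \<open>y\<close> is the pair of arcs \<open>(x, y)\<close>,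
  \<open>(y, x)\<close>. Functions on the vertex set are total functions on the type \<open>'a\<close>; at a vertex, none of
  the operators below depends on their values outside \<open>pverts G\<close>.
\<close>

text \<open>All edge weights and the vertex measure are 1.\<close>

definition laplacian :: "'a pair_pre_digraph \<Rightarrow> ('a \<Rightarrow> real) \<Rightarrow> 'a \<Rightarrow> real" where
  "laplacian G f x = (\<Sum>y | (x, y) \<in> parcs G. f y - f x)"

definition Gamma :: "'a pair_pre_digraph \<Rightarrow> ('a \<Rightarrow> real) \<Rightarrow> ('a \<Rightarrow> real) \<Rightarrow> 'a \<Rightarrow> real" where
  "Gamma G f g x =
     1 / 2 * (laplacian G (\<lambda>z. f z * g z) x - f x * laplacian G g x - g x * laplacian G f x)"

definition Gamma2 :: "'a pair_pre_digraph \<Rightarrow> ('a \<Rightarrow> real) \<Rightarrow> ('a \<Rightarrow> real) \<Rightarrow> 'a \<Rightarrow> real" where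
  "Gamma2 G f g x =
     1 / 2 * (laplacian G (Gamma G f g) x
              - Gamma G f (laplacian G g) x - Gamma G g (laplacian G f) x)"

definition CD_0_infinity :: "'a pair_pre_digraph \<Rightarrow> bool" where
  "CD_0_infinity G \<longleftrightarrow> (\<forall>f. \<forall>x \<in> pverts G. Gamma2 G f f x \<ge> 0)"

definition max_degree :: "'a pair_pre_digraph \<Rightarrow> nat" where
  "max_degree G = Max (out_degree (with_proj G) ` pverts G)"

text \<open>
  An undirected edge between \<open>S\<close> and its complement has exactly one of its two arcs leaving \<open>S\<close>, so
  these arcs count \<open>|E(S, V \ S)|\<close>.
\<close>

definition edge_boundary :: "'a pair_pre_digraph \<Rightarrow> 'a set \<Rightarrow> ('a \<times> 'a) set" where
  "edge_boundary G S = {(x, y) \<in> parcs G. x \<in> S \<and> y \<in> pverts G - S}"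

definition expansion :: "'a pair_pre_digraph \<Rightarrow> 'a set \<Rightarrow> real" where
  "expansion G S = real (card (edge_boundary G S)) / real (card S)"

text \<open>
  The parts of a partition are necessarily distinct, so the partitions into \<open>k\<close> nonempty parts
  \<open>S\<^sub>1, \<dots>, S\<^sub>k\<close> are, up to the order of the parts, the partitions \<open>P\<close> with \<open>k\<close> elements. There are
  finitely many of them, and at least one if \<open>1 \<le> k \<le> |V|\<close>.
\<close>

definition multiway_isoperimetric :: "nat \<Rightarrow> 'a pair_pre_digraph \<Rightarrow> ereal" where
  "multiway_isoperimetric k G =
     (if card (pverts G) < k then \<infinity>
      else ereal (Min {Max (expansion G ` P) | P. partition_on (pverts G) P \<and> card P = k}))"

definition multiway_expanders :: "nat \<Rightarrow> (nat \<Rightarrow> 'a pair_pre_digraph) \<Rightarrow> bool" where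
  "multiway_expanders k G \<longleftrightarrow>
     (SUP m. enat (max_degree (G m))) < \<infinity> \<and>
     filterlim (\<lambda>m. card (pverts (G m))) at_top sequentially \<and>
     (INF m. multiway_isoperimetric k (G m)) > 0"

end

theory Submission
  imports Defs "HOL-Library.Indicator_Function"
begin

text \<open>
  For every \<open>k\<close>, \<open>k\<close>-way expanders are compared with 2-way expanders. One direction is elementary:
  a partition into at least two parts has a part \<open>T\<close> with at most half of the vertices, and the cut
  into \<open>T\<close> and its complement is no worse than \<open>T\<close> itself, so
  \<open>h\<^sub>2 \<le> h\<^sub>l\<close> (\<open>two_way_le_multiway\<close>).

  For the converse it is shown that \<open>h\<^sub>l \<le> C h\<^sub>2\<close> with \<open>C\<close> depending only on \<open>l\<close> and a degree bound
  \<open>D\<close>, as soon as \<open>h = h\<^sub>2\<close> is small (\<open>multiway_le_two_way\<close>). The idea is that under nonnegative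
  curvature a sparse cut cannot be a sharp bottleneck: it widens into a long cylinder, which can then
  be cut at many places. Let \<open>S\<close> be an optimal cut with at most half of the vertices and apply to its
  indicator function a smoothing operator, here the \<open>n\<close>-th power of the resolvent
  \<open>(1 - \<Delta> / D)\<^sup>-\<^sup>1\<close>, a discrete-time substitute for the heat semigroup. Nonnegative curvature gives
  the gradient estimate \<open>\<Gamma>(u\<^sub>n\<^sub>+\<^sub>1) \<le> D / (2 n)\<close> for initial data bounded by 1
  (\<open>resolvent_iterate_gradient_estimate\<close>), and by duality it also bounds the \<open>L\<^sup>1\<close> distance travelled
  by the indicator of \<open>S\<close> by a multiple of \<open>sqrt n\<close> times the boundary size of \<open>S\<close>
  (\<open>resolvent_iterate_L1_distance\<close>). With \<open>n\<close> of order \<open>1 / h\<^sup>2\<close> this yields a function \<open>f\<close> that is close to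
  the indicator of \<open>S\<close> in \<open>L\<^sup>1\<close> and yet changes by at most \<open>L = 50 D h\<close> along every edge
  (\<open>smoothed_cut\<close>).

  Every superlevel set of \<open>f\<close> at a height in \<open>[1/4, 3/4]\<close> then has about \<open>|S|\<close> vertices, so by the
  definition of \<open>h\<^sub>2\<close> its boundary has at least \<open>h |S| / 2\<close> edges. The boundary edges at height \<open>s\<close>
  start at vertices with \<open>s \<le> f < s + L\<close>. Stacking such heights shows that a band \<open>{a \<le> f < b}\<close>
  contains, up to a factor depending on \<open>D\<close>, at least \<open>(b - a) |S|\<close> vertices (\<open>band_card_ge\<close>): the
  factor \<open>h\<close> from the boundary cancels against the factor \<open>h\<close> in the step size \<open>L\<close>. On the other hand, among about
  \<open>1 / L\<close> concentric bands shrinking by \<open>L\<close> at both ends, one has few boundary edges, because the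
  collars between them are disjoint (\<open>sparse_nested_band\<close>). Taking \<open>l - 1\<close> disjoint
  bands and the rest of the graph gives \<open>l\<close> parts, each of expansion of order \<open>h\<close>.
\<close>

section \<open>Calculus of the graph Laplacian\<close>

context pair_graph
begin

lemma finite_nbrs [simp]: "finite {y. (x, y) \<in> parcs G}"
proof (rule finite_subset)
  show "{y. (x, y) \<in> parcs G} \<subseteq> pverts G"
    by (auto dest: in_arcsD2)
qed (rule pair_finite_verts)

lemma arc_sym: "(x, y) \<in> parcs G \<Longrightarrow> (y, x) \<in> parcs G"
  using pair_sym_arcs by (auto simp: symmetric_def dest: symD)

lemma laplacian_add_scaled:
  "laplacian G (\<lambda>z. f z + c * g z) x = laplacian G f x + c * laplacian G g x"
  unfolding laplacian_def sum_distrib_left sum.distrib[symmetric]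
  by (rule sum.cong) (auto simp: algebra_simps)

lemma Gamma_eq_sum:
  "Gamma G f g x = (\<Sum>y | (x, y) \<in> parcs G. (f y - f x) * (g y - g x)) / 2"
proof -
  have "(\<Sum>y | (x, y) \<in> parcs G. (f y - f x) * (g y - g x)) =
      laplacian G (\<lambda>z. f z * g z) x - f x * laplacian G g x - g x * laplacian G f x"
    unfolding laplacian_def sum_distrib_left sum_subtractf[symmetric]
    by (rule sum.cong) (auto simp: algebra_simps)
  then show ?thesis
    by (simp add: Gamma_def)
qed

lemma Gamma_nonneg: "0 \<le> Gamma G f f x"
  unfolding Gamma_eq_sum by (simp add: sum_nonneg)

text \<open>
  This turns pointwise bounds on \<open>\<Gamma>(f)\<close> into Lipschitz bounds along edges.
\<close>

lemma arc_difference_le_Gamma: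
  assumes "(x, y) \<in> parcs G"
  shows "(f y - f x)\<^sup>2 \<le> 2 * Gamma G f f x"
proof -
  have "(f y - f x)\<^sup>2 \<le> (\<Sum>y | (x, y) \<in> parcs G. (f y - f x)\<^sup>2)"
    using assms by (intro member_le_sum) auto
  then show ?thesis
    by (simp add: Gamma_eq_sum power2_eq_square)
qed

lemma sum_over_arcs_swap:
  fixes h :: "'a \<Rightarrow> 'a \<Rightarrow> real"
  shows "(\<Sum>(x, y) | (x, y) \<in> parcs G \<and> x \<in> S \<and> y \<in> T. h x y) =
    (\<Sum>(x, y) | (x, y) \<in> parcs G \<and> x \<in> T \<and> y \<in> S. h y x)"
  by (rule sum.reindex_bij_witness[where i = prod.swap and j = prod.swap]) (auto dest: arc_sym)

lemma sum_over_nbrs: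
  fixes h :: "'a \<Rightarrow> 'a \<Rightarrow> real"
  assumes "S \<subseteq> pverts G"
  shows "(\<Sum>x\<in>S. \<Sum>y | (x, y) \<in> parcs G. h x y) =
    (\<Sum>(x, y) | (x, y) \<in> parcs G \<and> x \<in> S \<and> y \<in> pverts G. h x y)"
proof -
  have "finite S"
    using assms pair_finite_verts finite_subset by blast
  then have "(\<Sum>x\<in>S. \<Sum>y | (x, y) \<in> parcs G. h x y) =
      (\<Sum>(x, y)\<in>Sigma S (\<lambda>x. {y. (x, y) \<in> parcs G}). h x y)"
    by (subst sum.Sigma) auto
  also have "Sigma S (\<lambda>x. {y. (x, y) \<in> parcs G}) =
      {(x, y). (x, y) \<in> parcs G \<and> x \<in> S \<and> y \<in> pverts G}"
    by (auto dest: in_arcsD2)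
  finally show ?thesis .
qed

lemma laplacian_symmetric:
  "(\<Sum>x\<in>pverts G. f x * laplacian G g x) = (\<Sum>x\<in>pverts G. g x * laplacian G f x)"
proof -
  let ?A = "{(x, y). (x, y) \<in> parcs G \<and> x \<in> pverts G \<and> y \<in> pverts G}"
  have expand: "(\<Sum>x\<in>pverts G. f x * laplacian G g x) =
      (\<Sum>(x, y)\<in>?A. f x * g y) - (\<Sum>(x, y)\<in>?A. f x * g x)" for f g :: "'a \<Rightarrow> real"
    unfolding laplacian_def sum_distrib_left
    by (subst sum_over_nbrs) (simp_all add: sum_subtractf[symmetric] algebra_simps split_def)
  have "(\<Sum>(x, y)\<in>?A. f x * g y) = (\<Sum>(x, y)\<in>?A. g x * f y)"
    by (subst sum_over_arcs_swap) (simp add: mult.commute)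
  then show ?thesis
    unfolding expand[of f g] expand[of g f] by (simp add: mult.commute)
qed

text \<open>
  The discrete divergence theorem: edges inside \<open>S\<close> contribute both of their arcs, and these cancel.
\<close>

lemma sum_laplacian_eq_flux:
  assumes "S \<subseteq> pverts G"
  shows "(\<Sum>x\<in>S. laplacian G g x) = (\<Sum>(x, y)\<in>edge_boundary G S. g y - g x)"
proof -
  let ?in = "{(x, y). (x, y) \<in> parcs G \<and> x \<in> S \<and> y \<in> S}"
  have fin: "finite ?in" "finite (edge_boundary G S)"
    by (rule finite_subset[OF _ pair_finite_arcs], auto simp: edge_boundary_def)+
  have "(\<Sum>x\<in>S. laplacian G g x) =
      (\<Sum>(x, y) | (x, y) \<in> parcs G \<and> x \<in> S \<and> y \<in> pverts G. g y - g x)"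
    unfolding laplacian_def by (rule sum_over_nbrs[OF assms])
  also have "{(x, y). (x, y) \<in> parcs G \<and> x \<in> S \<and> y \<in> pverts G} = ?in \<union> edge_boundary G S"
    using assms by (auto simp: edge_boundary_def)
  also have "(\<Sum>(x, y)\<in>?in \<union> edge_boundary G S. g y - g x) =
      (\<Sum>(x, y)\<in>?in. g y - g x) + (\<Sum>(x, y)\<in>edge_boundary G S. g y - g x)"
    using fin by (intro sum.union_disjoint) (auto simp: edge_boundary_def)
  also have "(\<Sum>(x, y)\<in>?in. g y - g x) = 0"
  proof -
    have "(\<Sum>(x, y)\<in>?in. g y - g x) = (\<Sum>(x, y)\<in>?in. g x - g y)"
      by (rule sum_over_arcs_swap)
    also have "\<dots> = - (\<Sum>(x, y)\<in>?in. g y - g x)"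
      by (simp add: sum_negf[symmetric] split_def)
    finally show ?thesis by simp
  qed
  finally show ?thesis by simp
qed


section \<open>Isoperimetric constants\<close>

lemma finite_edge_boundary [simp]: "finite (edge_boundary G S)"
  by (rule finite_subset[OF _ pair_finite_arcs]) (auto simp: edge_boundary_def)

lemma card_edge_boundary_complement:
  assumes "S \<subseteq> pverts G"
  shows "card (edge_boundary G (pverts G - S)) = card (edge_boundary G S)"
proof -
  have "bij_betw prod.swap (edge_boundary G (pverts G - S)) (edge_boundary G S)"
    by (rule bij_betw_byWitness[where f' = prod.swap])
      (use assms in \<open>auto simp: edge_boundary_def dest: arc_sym\<close>)
  then show ?thesis
    by (rule bij_betw_same_card)
qed

text \<open>
  A path from inside to outside must cross the boundary. This keeps the isoperimetric constant of a
  connected graph positive, so that the length scales \<open>1 / h\<close> used below are finite.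
\<close>

lemma edge_boundary_nonempty:
  assumes conn: "Digraph_Component.connected (with_proj G)"
    and S: "S \<subseteq> pverts G" "S \<noteq> {}" "S \<noteq> pverts G"
  shows "edge_boundary G S \<noteq> {}"
proof
  assume empty: "edge_boundary G S = {}"
  obtain x y where x: "x \<in> S" and y: "y \<in> pverts G" "y \<notin> S"
    using S by auto
  have "strongly_connected (with_proj G)"
    using conn pair_sym_arcs by (rule symmetric_connected_imp_strongly_connected[rotated])
  then have "x \<rightarrow>\<^sup>*\<^bsub>with_proj G\<^esub> y"
    using x y S by (auto simp: strongly_connected_def)
  then have "y \<in> S"
  proof (induction rule: reachable_induct)
    case base
    show ?case by (rule x)
  next
    case (step u v)
    then have "(u, v) \<in> parcs G" by simp
    then show ?case
      using step.IH empty in_arcsD2[of u v] by (auto simp: edge_boundary_def)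
  qed
  with y show False by simp
qed

lemma finite_parts:
  assumes "partition_on (pverts G) P"
  shows "finite P" "T \<in> P \<Longrightarrow> finite T \<and> T \<subseteq> pverts G \<and> T \<noteq> {}"
proof -
  show "finite P"
    using finite_elements[OF pair_finite_verts assms] .
  show "finite T \<and> T \<subseteq> pverts G \<and> T \<noteq> {}" if "T \<in> P"
    using that assms pair_finite_verts partition_onD1[OF assms] partition_onD3[OF assms]
    by (auto intro: finite_subset)
qed

lemma card_parts_le:
  assumes P: "partition_on (pverts G) P"
  shows "card P \<le> card (pverts G)"
proof -
  have "card P = (\<Sum>T\<in>P. 1)"
    by simp
  also have "\<dots> \<le> (\<Sum>T\<in>P. card T)"
    using finite_parts[OF P] by (intro sum_mono) (simp add: Suc_leI card_gt_0_iff)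
  also have "\<dots> = card (\<Union> P)"
    using finite_parts[OF P] partition_onD2[OF P]
    by (intro card_Union_disjoint[symmetric]) (auto simp: disjoint_def pairwise_def disjnt_def)
  finally show ?thesis
    using partition_onD1[OF P] by simp
qed

text \<open>
  The minimum in the definition of \<open>multiway_isoperimetric\<close> is over a nonempty set. The witness consists of
  \<open>k - 1\<close> singletons and the rest.
\<close>

lemma partition_with_card_exists:
  assumes "1 \<le> k" "k \<le> card (pverts G)"
  shows "\<exists>P. partition_on (pverts G) P \<and> card P = k"
proof -
  have "k - 1 \<le> card (pverts G)"
    using assms by simp
  then obtain U where U: "U \<subseteq> pverts G" "card U = k - 1" "finite U"
    by (rule obtain_subset_with_card_n)
  let ?P = "insert (pverts G - U) ((\<lambda>x. {x}) ` U)"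
  have nonempty: "pverts G - U \<noteq> {}"
  proof
    assume "pverts G - U = {}"
    then have "pverts G = U" using U by auto
    then show False using U assms by simp
  qed
  have "partition_on (pverts G) ?P"
    using U nonempty by (intro partition_onI) (auto simp: disjnt_def)
  moreover have "pverts G - U \<notin> (\<lambda>x. {x}) ` U"
    by auto
  then have "card ?P = k"
    using U assms by (simp add: card_image)
  ultimately show ?thesis
    by blast
qed

lemma finite_partition_values:
  "finite {Max (expansion G ` P) | P. partition_on (pverts G) P \<and> card P = k}"
proof -
  have "{P. partition_on (pverts G) P \<and> card P = k} \<subseteq> Pow (Pow (pverts G))"
    by (auto simp: partition_on_def)
  then have "finite {P. partition_on (pverts G) P \<and> card P = k}"
    using pair_finite_verts by (auto intro: finite_subset)
  then show ?thesis
    by simp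
qed

lemma multiway_isoperimetric_le:
  assumes P: "partition_on (pverts G) P" "card P = k" "P \<noteq> {}"
    and bound: "\<And>T. T \<in> P \<Longrightarrow> expansion G T \<le> c"
  shows "multiway_isoperimetric k G \<le> ereal c"
proof -
  have "Min {Max (expansion G ` P) | P. partition_on (pverts G) P \<and> card P = k}
      \<le> Max (expansion G ` P)"
    using P by (intro Min_le finite_partition_values) auto
  also have "\<dots> \<le> c"
    using P(3) finite_parts(1)[OF P(1)] bound by simp
  finally show ?thesis
    using card_parts_le[OF P(1)] P(2) by (simp add: multiway_isoperimetric_def)
qed

lemma multiway_isoperimetric_attained:
  assumes "1 \<le> k" "k \<le> card (pverts G)"
  obtains P where "partition_on (pverts G) P" "card P = k"
    "multiway_isoperimetric k G = ereal (Max (expansion G ` P))"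
proof -
  have "Min {Max (expansion G ` P) | P. partition_on (pverts G) P \<and> card P = k} \<in>
      {Max (expansion G ` P) | P. partition_on (pverts G) P \<and> card P = k}"
    using partition_with_card_exists[OF assms] by (intro Min_in finite_partition_values) auto
  with assms that show ?thesis
    by (auto simp: multiway_isoperimetric_def)
qed

text \<open>
  Both sides of a cut have the same boundary, so the smaller side has the larger expansion, and it
  alone determines the value of the cut.
\<close>

lemma two_way_isoperimetric_le:
  assumes A: "A \<subseteq> pverts G" "A \<noteq> {}" "2 * card A \<le> card (pverts G)"
  shows "multiway_isoperimetric 2 G \<le> ereal (expansion G A)"
proof (rule multiway_isoperimetric_le[where P = "{A, pverts G - A}"])
  have fin: "finite A"
    using A(1) pair_finite_verts by (rule finite_subset)
  then have pos: "0 < card A"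
    using A(2) by (simp add: card_gt_0_iff)
  have complement: "card (pverts G - A) = card (pverts G) - card A"
    using A fin by (simp add: card_Diff_subset)
  then have larger: "card A \<le> card (pverts G - A)"
    using A(3) by linarith
  then have ne: "pverts G - A \<noteq> {}"
    using pos by (metis card.empty not_le)
  have diff: "A \<noteq> pverts G - A"
    using A by auto
  show "partition_on (pverts G) {A, pverts G - A}"
    using A ne by (intro partition_onI) (auto simp: disjnt_def)
  show "card {A, pverts G - A} = 2"
    using diff by simp
  show "expansion G T \<le> expansion G A" if "T \<in> {A, pverts G - A}" for T
    using that larger pos
    by (auto simp: expansion_def card_edge_boundary_complement[OF A(1)] intro!: divide_left_mono)
qed simp

lemma small_part_exists:
  assumes P: "partition_on (pverts G) P" and "2 \<le> card P"
  obtains T where "T \<in> P" "2 * card T \<le> card (pverts G)"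
proof -
  obtain T U where TU: "T \<in> P" "U \<in> P" "T \<noteq> U"
    using \<open>2 \<le> card P\<close> by (metis card_2_iff' obtain_subset_with_card_n subset_iff)
  then have "T \<inter> U = {}"
    using partition_onD2[OF P] by (auto simp: disjoint_def)
  then have "card T + card U = card (T \<union> U)"
    using finite_parts(2)[OF P] TU by (simp add: card_Un_disjoint)
  also have "\<dots> \<le> card (pverts G)"
    using finite_parts(2)[OF P] TU pair_finite_verts by (intro card_mono) auto
  finally have "2 * card T \<le> card (pverts G) \<or> 2 * card U \<le> card (pverts G)"
    by linarith
  with TU that show ?thesis
    by blast
qed

lemma two_way_le_multiway:
  assumes "2 \<le> l"
  shows "multiway_isoperimetric 2 G \<le> multiway_isoperimetric l G"
proof (cases "card (pverts G) < l")
  case True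
  then show ?thesis
    by (simp add: multiway_isoperimetric_def)
next
  case False
  then obtain P where P: "partition_on (pverts G) P" "card P = l"
    "multiway_isoperimetric l G = ereal (Max (expansion G ` P))"
    using assms by (auto intro: multiway_isoperimetric_attained[of l])
  then obtain T where T: "T \<in> P" "2 * card T \<le> card (pverts G)"
    using assms small_part_exists by blast
  have "multiway_isoperimetric 2 G \<le> ereal (expansion G T)"
    using finite_parts(2)[OF P(1) T(1)] T(2) by (intro two_way_isoperimetric_le) auto
  also have "expansion G T \<le> Max (expansion G ` P)"
    using T finite_parts(1)[OF P(1)] by simp
  finally show ?thesis
    using P(3) by simp
qed

lemma two_way_optimal_cut:
  fixes h :: real
  assumes h: "multiway_isoperimetric 2 G = ereal h"
  obtains S where "S \<subseteq> pverts G" "S \<noteq> {}" "2 * card S \<le> card (pverts G)"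
    "card (edge_boundary G S) \<le> h * card S"
proof -
  have "2 \<le> card (pverts G)"
    using h by (simp add: multiway_isoperimetric_def split: if_splits)
  then obtain P where P: "partition_on (pverts G) P" "card P = 2"
    "multiway_isoperimetric 2 G = ereal (Max (expansion G ` P))"
    by (auto intro: multiway_isoperimetric_attained[of 2])
  obtain S where S: "S \<in> P" "2 * card S \<le> card (pverts G)"
    using small_part_exists[OF P(1)] P(2) by auto
  note S' = finite_parts(2)[OF P(1) S(1)]
  have "expansion G S \<le> h"
    using S(1) finite_parts(1)[OF P(1)] P(3) h by simp
  moreover have "0 < card S"
    using S' by (simp add: card_gt_0_iff)
  ultimately have "card (edge_boundary G S) \<le> h * card S"
    by (simp add: expansion_def divide_le_eq)
  with S S' that show ?thesis
    by blast
qed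

text \<open>
  Stating the inequality with any lower bound \<open>c\<close> for both sides of the cut avoids a case distinction about
  which side is the smaller one; the level sets below come with such a bound.
\<close>

lemma isoperimetric_inequality:
  fixes h :: real
  assumes h: "multiway_isoperimetric 2 G = ereal h" "0 \<le> h" and A: "A \<subseteq> pverts G"
    and c: "c \<le> real (card A)" "c \<le> real (card (pverts G - A))" "0 < c"
  shows "h * c \<le> card (edge_boundary G A)"
proof -
  have small: "h * c \<le> card (edge_boundary G B)"
    if B: "B \<subseteq> pverts G" "2 * card B \<le> card (pverts G)" "c \<le> real (card B)" for B
  proof -
    have "0 < card B"
      using B(3) c(3) by linarith
    then have "B \<noteq> {}"
      by auto
    then have "h \<le> expansion G B"
      using two_way_isoperimetric_le[of B] B h by auto
    then have "h * card B \<le> card (edge_boundary G B)"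
      using \<open>0 < card B\<close> by (simp add: expansion_def le_divide_eq)
    moreover have "h * c \<le> h * card B"
      using B(3) h(2) by (rule mult_left_mono)
    ultimately show ?thesis by linarith
  qed
  have "card (pverts G - A) = card (pverts G) - card A"
    using A pair_finite_verts by (simp add: card_Diff_subset finite_subset)
  then consider "2 * card A \<le> card (pverts G)" | "2 * card (pverts G - A) \<le> card (pverts G)"
    by linarith
  then show ?thesis
  proof cases
    case 1
    then show ?thesis using small[of A] A c by simp
  next
    case 2
    then show ?thesis
      using small[of "pverts G - A"] c card_edge_boundary_complement[OF A] by simp
  qed
qed
end

section \<open>The resolvent of the Laplacian\<close>

text \<open>
  Because \<open>D\<close> bounds all degrees, the operator \<open>1 + \<Delta> / D\<close> is a lazy random walk, and \<open>1 / D\<close> is used as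
  the unit of time. The bound \<open>1 \<le> D\<close> allows \<open>sqrt D\<close> to be absorbed into \<open>D\<close> in the estimates.
\<close>

locale bounded_degree_graph = pair_graph G for G :: "'a pair_pre_digraph" +
  fixes D :: real
  assumes D_ge_1: "1 \<le> D"
    and degree_le: "real (card {y. (x, y) \<in> parcs G}) \<le> D"
begin

lemma D_pos: "0 < D"
  using D_ge_1 by simp

text \<open>
  At a maximum of \<open>u\<close> the Laplacian is nonpositive, so there the hypothesis already bounds \<open>u\<close>.
\<close>

lemma maximum_principle:
  assumes sub: "\<And>x. x \<in> pverts G \<Longrightarrow> u x - laplacian G u x / D \<le> M"
    and x: "x \<in> pverts G"
  shows "u x \<le> M"
proof -
  have "Max (u ` pverts G) \<in> u ` pverts G"
    using x pair_finite_verts by (intro Max_in) auto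
  then obtain z where z: "z \<in> pverts G" "Max (u ` pverts G) = u z"
    by auto
  have z_max: "u y \<le> u z" if "y \<in> pverts G" for y
    using that pair_finite_verts unfolding z(2)[symmetric] by (intro Max_ge) auto
  have "laplacian G u z \<le> 0"
    unfolding laplacian_def by (rule sum_nonpos) (auto dest: in_arcsD2 intro: z_max)
  then have "laplacian G u z / D \<le> 0"
    using D_pos by (simp add: divide_nonpos_pos)
  then have "u z \<le> M"
    using sub[OF z(1)] by linarith
  then show ?thesis
    using z_max[OF x] by linarith
qed

definition lazy_walk :: "('a \<Rightarrow> real) \<Rightarrow> 'a \<Rightarrow> real" where
  "lazy_walk f x = f x + laplacian G f x / D"

text \<open>
  Since no degree exceeds \<open>D\<close>, the new value is a convex combination of old ones.
\<close>

lemma lazy_walk_bound: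
  assumes "\<And>y. y \<in> pverts G \<Longrightarrow> \<bar>f y\<bar> \<le> B" and x: "x \<in> pverts G"
  shows "\<bar>lazy_walk f x\<bar> \<le> B"
proof -
  define d where "d = real (card {y. (x, y) \<in> parcs G})"
  have d: "0 \<le> d" "d \<le> D"
    using degree_le[of x] by (auto simp: d_def)
  have "laplacian G f x = (\<Sum>y | (x, y) \<in> parcs G. f y) - d * f x"
    by (simp add: laplacian_def sum_subtractf d_def)
  then have "lazy_walk f x = (1 - d / D) * f x + (\<Sum>y | (x, y) \<in> parcs G. f y) / D"
    by (simp add: lazy_walk_def diff_divide_distrib left_diff_distrib)
  moreover have "\<bar>(1 - d / D) * f x\<bar> \<le> (1 - d / D) * B"
    using d D_pos assms(1)[OF x] by (simp add: abs_mult mult_left_mono)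
  moreover have "\<bar>(\<Sum>y | (x, y) \<in> parcs G. f y) / D\<bar> \<le> d * B / D"
  proof -
    have "\<bar>\<Sum>y | (x, y) \<in> parcs G. f y\<bar> \<le> (\<Sum>y | (x, y) \<in> parcs G. \<bar>f y\<bar>)"
      by (rule sum_abs)
    also have "\<dots> \<le> d * B"
      unfolding d_def by (rule sum_bounded_above) (auto intro: assms(1) dest: in_arcsD2)
    finally show ?thesis
      using D_pos by (simp add: divide_right_mono)
  qed
  ultimately have "\<bar>lazy_walk f x\<bar> \<le> (1 - d / D) * B + d * B / D"
    by (simp only: order_trans[OF abs_triangle_ineq add_mono])
  then show ?thesis
    by (simp add: algebra_simps)
qed

text \<open>
  With the walk \<open>P = 1 + \<Delta> / D\<close> the equation reads \<open>2 u - P u = f\<close>, which is solved by the Neumann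
  series \<open>\<Sum>\<^sub>k 2\<^sup>-\<^sup>(\<^sup>k\<^sup>+\<^sup>1\<^sup>) P\<^sup>k f\<close>; it converges because \<open>P\<close> does not increase the supremum norm.
\<close>

lemma resolvent_exists:
  "\<exists>u. \<forall>x\<in>pverts G. u x - laplacian G u x / D = f x"
proof -
  define w where "w k = (lazy_walk ^^ k) f" for k
  define u where "u x = (\<Sum>k. (1/2) ^ Suc k * w k x)" for x
  define B where "B = (\<Sum>x\<in>pverts G. \<bar>f x\<bar>)"
  have w_Suc: "w (Suc k) x = w k x + laplacian G (w k) x / D" for k x
    by (simp add: w_def lazy_walk_def)
  have bound: "\<bar>w k x\<bar> \<le> B" if "x \<in> pverts G" for k x
    using that
  proof (induction k arbitrary: x)
    case 0
    then show ?case
      unfolding w_def B_def using pair_finite_verts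
      by (auto intro: member_le_sum[where f = "\<lambda>x. \<bar>f x\<bar>"])
  next
    case (Suc k)
    then show ?case
      using lazy_walk_bound[of "w k" B x] by (simp add: w_def)
  qed
  have sums: "(\<lambda>k. (1/2) ^ Suc k * w k x) sums u x" if x: "x \<in> pverts G" for x
  proof -
    have "summable (\<lambda>k. (1/2) ^ Suc k * w k x)"
    proof (rule summable_comparison_test')
      show "summable (\<lambda>k. (1/2) ^ k * B)"
        by (intro summable_mult2 summable_geometric) simp
      show "norm ((1/2) ^ Suc k * w k x) \<le> (1/2) ^ k * B" if "0 \<le> k" for k
      proof -
        have "(1/2::real) ^ Suc k \<le> (1/2) ^ k"
          by simp
        then show ?thesis
          using bound[OF x, of k] by (simp add: abs_mult mult_mono del: power_Suc)
      qed
    qed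
    then show ?thesis
      unfolding u_def by (rule summable_sums)
  qed
  have "u x - laplacian G u x / D = f x" if x: "x \<in> pverts G" for x
  proof -
    have "(\<lambda>k. \<Sum>y | (x, y) \<in> parcs G. (1/2) ^ Suc k * w k y - (1/2) ^ Suc k * w k x)
        sums laplacian G u x"
      unfolding laplacian_def using x by (intro sums_sum sums_diff sums) (auto dest: in_arcsD2)
    then have "(\<lambda>k. (1/2) ^ Suc k * laplacian G (w k) x) sums laplacian G u x"
      by (simp add: laplacian_def sum_distrib_left right_diff_distrib)
    \<comment> \<open>The series of \<open>P u\<close> is the shifted series of \<open>2 u\<close>, with the initial term \<open>f\<close> missing.\<close>
    from sums_add[OF sums[OF x] sums_divide[OF this, of D]]
    have "(\<lambda>k. (1/2) ^ Suc k * w (Suc k) x) sums (u x + laplacian G u x / D)"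
      by (simp only: w_Suc distrib_left times_divide_eq_right)
    from sums_divide[OF this, of 2]
    have "(\<lambda>k. (1/2) ^ Suc (Suc k) * w (Suc k) x) sums ((u x + laplacian G u x / D) / 2)"
      by simp
    from sums_Suc[OF this]
    have "(\<lambda>k. (1/2) ^ Suc k * w k x) sums ((u x + laplacian G u x / D) / 2 + f x / 2)"
      by (simp add: w_def)
    with sums[OF x] have "u x = (u x + laplacian G u x / D) / 2 + f x / 2"
      by (rule sums_unique2)
    then show ?thesis
      by (simp add: field_simps)
  qed
  then show ?thesis
    by blast
qed

text \<open>
  Only the values on the vertex set are determined by the equation, and only those are used.
\<close>

definition resolvent :: "('a \<Rightarrow> real) \<Rightarrow> 'a \<Rightarrow> real" where
  "resolvent f = (SOME u. \<forall>x\<in>pverts G. u x - laplacian G u x / D = f x)"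

lemma resolvent_equation:
  "x \<in> pverts G \<Longrightarrow> resolvent f x - laplacian G (resolvent f) x / D = f x"
  using someI_ex[OF resolvent_exists[of f]] by (auto simp: resolvent_def)

lemma scaled_laplacian_resolvent:
  "x \<in> pverts G \<Longrightarrow> laplacian G (resolvent f) x / D = resolvent f x - f x"
  using resolvent_equation[of x f] by simp

lemma laplacian_resolvent:
  "x \<in> pverts G \<Longrightarrow> laplacian G (resolvent f) x = D * (resolvent f x - f x)"
  using resolvent_equation[of x f] D_pos by (simp add: field_simps)

lemma resolvent_le:
  assumes "\<And>x. x \<in> pverts G \<Longrightarrow> f x \<le> M" and "x \<in> pverts G"
  shows "resolvent f x \<le> M"
  by (rule maximum_principle) (use assms in \<open>auto simp: resolvent_equation\<close>)

lemma resolvent_ge: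
  assumes "\<And>x. x \<in> pverts G \<Longrightarrow> M \<le> f x" and "x \<in> pverts G"
  shows "M \<le> resolvent f x"
proof -
  have neg: "laplacian G (\<lambda>z. - resolvent f z) y = - laplacian G (resolvent f) y" for y
    by (simp add: laplacian_def sum_negf[symmetric])
  have "- resolvent f x \<le> - M"
  proof (rule maximum_principle[of "\<lambda>z. - resolvent f z"])
    show "- resolvent f z - laplacian G (\<lambda>z. - resolvent f z) z / D \<le> - M"
      if "z \<in> pverts G" for z
      using assms(1)[OF that] resolvent_equation[OF that, of f] by (simp add: neg)
  qed (rule assms(2))
  then show ?thesis by simp
qed

text \<open>
  Write \<open>f\<close> and \<open>g\<close> as \<open>1 - \<Delta> / D\<close> applied to their resolvents and use the symmetry of \<open>\<Delta>\<close>.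
\<close>

lemma resolvent_symmetric:
  "(\<Sum>x\<in>pverts G. f x * resolvent g x) = (\<Sum>x\<in>pverts G. resolvent f x * g x)"
proof -
  have "(\<Sum>x\<in>pverts G. f x * resolvent g x) =
      (\<Sum>x\<in>pverts G. resolvent f x * resolvent g x)
      - (\<Sum>x\<in>pverts G. resolvent g x * laplacian G (resolvent f) x) / D"
    unfolding sum_divide_distrib sum_subtractf[symmetric]
    by (rule sum.cong) (simp_all only: times_divide_eq_right[symmetric]
        scaled_laplacian_resolvent right_diff_distrib, simp_all)
  also have "\<dots> = (\<Sum>x\<in>pverts G. resolvent f x * resolvent g x)
      - (\<Sum>x\<in>pverts G. resolvent f x * laplacian G (resolvent g) x) / D"
    by (simp only: laplacian_symmetric[of "resolvent g" "resolvent f"])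
  also have "\<dots> = (\<Sum>x\<in>pverts G. resolvent f x * g x)"
    unfolding sum_divide_distrib sum_subtractf[symmetric]
    by (rule sum.cong) (simp_all only: times_divide_eq_right[symmetric]
        scaled_laplacian_resolvent right_diff_distrib)
  finally show ?thesis .
qed

lemma resolvent_iterate_symmetric:
  "(\<Sum>x\<in>pverts G. f x * (resolvent ^^ n) g x) = (\<Sum>x\<in>pverts G. (resolvent ^^ n) f x * g x)"
proof (induction n arbitrary: f)
  case (Suc n)
  have "(\<Sum>x\<in>pverts G. f x * (resolvent ^^ Suc n) g x) =
      (\<Sum>x\<in>pverts G. resolvent f x * (resolvent ^^ n) g x)"
    by (simp add: resolvent_symmetric)
  also have "\<dots> = (\<Sum>x\<in>pverts G. (resolvent ^^ Suc n) f x * g x)"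
    by (simp add: Suc funpow_swap1)
  finally show ?case .
qed simp

section \<open>Smoothing under nonnegative curvature\<close>

text \<open>
  This is \<open>\<Delta>(u\<^sup>2) = 2 u \<Delta> u + 2 \<Gamma>(u)\<close> with \<open>\<Delta> u = D (u - f)\<close>, after dropping the square of
  \<open>u - f\<close>. The gain \<open>2 \<Gamma>(u) / D\<close> per step is what pays for the gradient estimate.
\<close>

lemma resolvent_square_subsolution:
  fixes f :: "'a \<Rightarrow> real"
  assumes x: "x \<in> pverts G"
  defines "u \<equiv> resolvent f"
  shows "(u x)\<^sup>2 - laplacian G (\<lambda>z. (u z)\<^sup>2) x / D \<le> (f x)\<^sup>2 - 2 / D * Gamma G u u x"
proof -
  have "laplacian G (\<lambda>z. (u z)\<^sup>2) x = 2 * Gamma G u u x + 2 * u x * laplacian G u x"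
    by (simp add: Gamma_def power2_eq_square diff_divide_distrib)
  then have "laplacian G (\<lambda>z. (u z)\<^sup>2) x / D = 2 / D * Gamma G u u x + 2 * u x * (u x - f x)"
    using D_pos laplacian_resolvent[OF x, of f] by (simp add: u_def field_simps)
  moreover have "(u x)\<^sup>2 - 2 * u x * (u x - f x) = (f x)\<^sup>2 - (u x - f x)\<^sup>2"
    by (simp add: power2_eq_square algebra_simps)
  ultimately show ?thesis
    using zero_le_power2[of "u x - f x"] by linarith
qed

text \<open>
  The only use of curvature. Nonnegativity of \<open>\<Gamma>\<^sub>2(u)\<close> gives
  \<open>\<Delta> \<Gamma>(u) / D \<ge> 2 \<Gamma>(u, \<Delta> u) / D = 2 \<Gamma>(u, u - f)\<close>, and
  \<open>\<Gamma>(u) - 2 \<Gamma>(u, u - f) = \<Gamma>(f) - \<Gamma>(u - f) \<le> \<Gamma>(f)\<close>. Hence one resolvent step does not increase the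
  gradient, in the sense that \<open>(1 - \<Delta> / D) \<Gamma>(u) \<le> \<Gamma>(f)\<close>.
\<close>

lemma resolvent_Gamma_subsolution:
  fixes f :: "'a \<Rightarrow> real"
  assumes CD: "CD_0_infinity G" and x: "x \<in> pverts G"
  defines "u \<equiv> resolvent f"
  shows "Gamma G u u x - laplacian G (Gamma G u u) x / D \<le> Gamma G f f x"
proof -
  let ?N = "{y. (x, y) \<in> parcs G}"
  have "0 \<le> Gamma2 G u u x"
    using CD x by (simp add: CD_0_infinity_def)
  then have "2 * Gamma G u (laplacian G u) x \<le> laplacian G (Gamma G u u) x"
    by (simp add: Gamma2_def)
  moreover have "Gamma G u (laplacian G u) x = D * Gamma G u (\<lambda>z. u z - f z) x"
  proof -
    have "(\<Sum>y\<in>?N. (u y - u x) * (laplacian G u y - laplacian G u x)) =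
        (\<Sum>y\<in>?N. D * ((u y - u x) * ((u y - f y) - (u x - f x))))"
      using x by (intro sum.cong) (auto simp: u_def laplacian_resolvent algebra_simps dest: in_arcsD2)
    then show ?thesis
      by (simp add: Gamma_eq_sum sum_distrib_left[symmetric])
  qed
  ultimately have "2 * Gamma G u (\<lambda>z. u z - f z) x \<le> laplacian G (Gamma G u u) x / D"
    using D_pos by (simp add: field_simps)
  moreover have "Gamma G u u x - 2 * Gamma G u (\<lambda>z. u z - f z) x \<le> Gamma G f f x"
  proof -
    have "(\<Sum>y\<in>?N. (u y - u x) * (u y - u x)) -
        2 * (\<Sum>y\<in>?N. (u y - u x) * ((u y - f y) - (u x - f x))) =
        (\<Sum>y\<in>?N. (u y - u x) * (u y - u x) - 2 * ((u y - u x) * ((u y - f y) - (u x - f x))))"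
      by (simp add: sum_subtractf sum_distrib_left)
    also have "\<dots> \<le> (\<Sum>y\<in>?N. (f y - f x) * (f y - f x))"
    proof (rule sum_mono)
      fix y
      have "0 \<le> ((u y - u x) - (f y - f x)) * ((u y - u x) - (f y - f x))"
        by simp
      then show "(u y - u x) * (u y - u x) - 2 * ((u y - u x) * ((u y - f y) - (u x - f x)))
          \<le> (f y - f x) * (f y - f x)"
        by (simp add: algebra_simps)
    qed
    finally show ?thesis
      by (simp add: Gamma_eq_sum)
  qed
  ultimately show ?thesis
    by linarith
qed

text \<open>
  The left-hand side is \<open>\<psi>\<^sub>n = u\<^sub>n\<^sup>2 + (2 n / D) \<Gamma>(u\<^sub>n\<^sub>+\<^sub>1)\<close>, the analogue of the function
  \<open>(P\<^sub>t f)\<^sup>2 + 2 t \<Gamma>(P\<^sub>t f)\<close> for the heat semigroup. The two previous lemmas combine to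
  \<open>(1 - \<Delta> / D) \<psi>\<^sub>n\<^sub>+\<^sub>1 \<le> \<psi>\<^sub>n\<close>, so the maximum of \<open>\<psi>\<^sub>n\<close> does not grow. The shift of the index
  in the gradient term matters: the square of \<open>u\<^sub>n\<^sub>+\<^sub>1\<close> gains \<open>(2 / D) \<Gamma>(u\<^sub>n\<^sub>+\<^sub>1)\<close>, while the step bounds
  \<open>\<Gamma>(u\<^sub>n\<^sub>+\<^sub>2)\<close> by that same \<open>\<Gamma>(u\<^sub>n\<^sub>+\<^sub>1)\<close>.
\<close>

lemma resolvent_iterate_gradient_estimate:
  fixes f :: "'a \<Rightarrow> real"
  assumes CD: "CD_0_infinity G" and f: "\<And>x. x \<in> pverts G \<Longrightarrow> \<bar>f x\<bar> \<le> 1"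
  defines "u \<equiv> \<lambda>n. (resolvent ^^ n) f"
  shows "x \<in> pverts G \<Longrightarrow> (u n x)\<^sup>2 + 2 * real n / D * Gamma G (u (Suc n)) (u (Suc n)) x \<le> 1"
proof (induction n arbitrary: x)
  case 0
  then show ?case
    using f by (simp add: u_def abs_square_le_1)
next
  case (Suc n)
  let ?\<Gamma> = "\<lambda>n. Gamma G (u n) (u n)"
  let ?c = "2 * real (Suc n) / D"
  let ?\<psi> = "\<lambda>z. (u (Suc n) z)\<^sup>2 + ?c * ?\<Gamma> (Suc (Suc n)) z"
  have "?\<psi> x \<le> 1"
  proof (rule maximum_principle[OF _ Suc.prems])
    fix z assume z: "z \<in> pverts G"
    have sq: "(u (Suc n) z)\<^sup>2 - laplacian G (\<lambda>z. (u (Suc n) z)\<^sup>2) z / D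
        \<le> (u n z)\<^sup>2 - 2 / D * ?\<Gamma> (Suc n) z"
      using resolvent_square_subsolution[OF z, of "u n"] by (simp add: u_def)
    have "?\<Gamma> (Suc (Suc n)) z - laplacian G (?\<Gamma> (Suc (Suc n))) z / D \<le> ?\<Gamma> (Suc n) z"
      using resolvent_Gamma_subsolution[OF CD z, of "u (Suc n)"] by (simp add: u_def)
    then have "?c * (?\<Gamma> (Suc (Suc n)) z - laplacian G (?\<Gamma> (Suc (Suc n))) z / D)
        \<le> ?c * ?\<Gamma> (Suc n) z"
      using D_pos by (intro mult_left_mono) auto
    moreover have "?\<psi> z - laplacian G ?\<psi> z / D =
        ((u (Suc n) z)\<^sup>2 - laplacian G (\<lambda>z. (u (Suc n) z)\<^sup>2) z / D)
        + ?c * (?\<Gamma> (Suc (Suc n)) z - laplacian G (?\<Gamma> (Suc (Suc n))) z / D)"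
      using D_pos unfolding laplacian_add_scaled by (simp add: field_simps)
    moreover have "?c = 2 / D + 2 * real n / D"
      by (simp add: add_divide_distrib)
    then have "?c * ?\<Gamma> (Suc n) z = 2 / D * ?\<Gamma> (Suc n) z + 2 * real n / D * ?\<Gamma> (Suc n) z"
      by (simp only: distrib_right)
    ultimately show "?\<psi> z - laplacian G ?\<psi> z / D \<le> 1"
      using sq Suc.IH[OF z] by linarith
  qed
  then show ?case .
qed

lemma resolvent_iterate_lipschitz:
  assumes CD: "CD_0_infinity G" and f: "\<And>x. x \<in> pverts G \<Longrightarrow> \<bar>f x\<bar> \<le> 1"
    and n: "0 < n" and arc: "(x, y) \<in> parcs G"
  shows "\<bar>(resolvent ^^ Suc n) f y - (resolvent ^^ Suc n) f x\<bar> \<le> sqrt (D / n)"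
proof -
  let ?u = "(resolvent ^^ Suc n) f"
  have x: "x \<in> pverts G"
    using arc by (rule in_arcsD1)
  have "2 * real n / D * Gamma G ?u ?u x \<le> 1"
    using resolvent_iterate_gradient_estimate[where f = f and n = n, OF CD f x] zero_le_power2[of "(resolvent ^^ n) f x"]
    by linarith
  then have "2 * Gamma G ?u ?u x \<le> D / n"
    using D_pos n by (simp add: field_simps)
  then have "(?u y - ?u x)\<^sup>2 \<le> D / n"
    using arc_difference_le_Gamma[OF arc, of ?u] by linarith
  then have "sqrt ((?u y - ?u x)\<^sup>2) \<le> sqrt (D / n)"
    by (rule real_sqrt_le_mono)
  then show ?thesis
    by simp
qed

lemma sum_inverse_sqrt_le: "(\<Sum>k=1..n. 1 / sqrt (real k)) \<le> 2 * sqrt (real n)"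
proof (induction n)
  case (Suc n)
  have "1 / sqrt (real (Suc n)) \<le> 2 * sqrt (real (Suc n)) - 2 * sqrt (real n)"
  proof -
    have "2 * sqrt (real n) * sqrt (real (Suc n)) \<le> real n + real (Suc n)"
      using zero_le_power2[of "sqrt (real n) - sqrt (real (Suc n))"] by (simp add: power2_diff)
    moreover have "sqrt (real (Suc n)) * sqrt (real (Suc n)) = real n + 1"
      by simp
    ultimately have "1 \<le> (2 * sqrt (real (Suc n)) - 2 * sqrt (real n)) * sqrt (real (Suc n))"
      by (simp add: algebra_simps)
    then show ?thesis
      by (simp add: divide_le_eq)
  qed
  then show ?case
    using Suc by simp
qed simp

text \<open>
  By duality: the \<open>L\<^sup>1\<close> norm is tested against its sign function \<open>g\<close>, and the resolvents are moved to
  \<open>g\<close>. The difference \<open>g - v\<^sub>N\<close> telescopes into Laplacians of the iterates \<open>v\<^sub>k\<close> of \<open>g\<close>, whose sums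
  over \<open>S\<close> are fluxes through the boundary; there the Lipschitz estimate for bounded data applies. The
  resulting bound \<open>\<Sum>\<^sub>k k\<^sup>-\<^sup>1\<^sup>/\<^sup>2\<close> grows only like \<open>sqrt n\<close>; without the decay of the
  gradients, the \<open>n\<close> steps would give a bound linear in \<open>n\<close>.
\<close>

lemma resolvent_iterate_L1_distance:
  assumes CD: "CD_0_infinity G" and S: "S \<subseteq> pverts G"
  shows "(\<Sum>x\<in>pverts G. \<bar>indicator S x - (resolvent ^^ Suc n) (indicator S) x\<bar>)
    \<le> (2 + 2 * sqrt n) * card (edge_boundary G S)"
proof -
  let ?f = "indicator S :: 'a \<Rightarrow> real"
  define N where "N = Suc n"
  define g where "g x = sgn (?f x - (resolvent ^^ N) ?f x)" for x
  define v where "v k = (resolvent ^^ k) g" for k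
  \<comment> \<open>The first iterate has no gradient estimate yet; its oscillation is bounded by that of \<open>g\<close>.\<close>
  define b where "b k = (if k = 0 then 2 else sqrt D / sqrt k)" for k :: nat
  have g: "\<bar>g x\<bar> \<le> 1" for x
    by (simp add: g_def sgn_real_def)
  have lip: "\<bar>v (Suc k) y - v (Suc k) x\<bar> \<le> b k" if "(x, y) \<in> parcs G" for k x y
  proof (cases "k = 0")
    case True
    have "\<bar>v (Suc 0) z\<bar> \<le> 1" if "z \<in> pverts G" for z
      using resolvent_le[of g 1 z] resolvent_ge[of "-1" g z] g that
      by (simp add: v_def abs_le_iff minus_le_iff)
    from this[OF in_arcsD1[OF that]] this[OF in_arcsD2[OF that]] show ?thesis
      using True by (simp add: b_def)
  next
    case False
    then show ?thesis
      using resolvent_iterate_lipschitz[OF CD g _ that, of k]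
      by (simp add: v_def b_def real_sqrt_divide)
  qed
  have flux: "\<bar>\<Sum>x\<in>S. laplacian G (v (Suc k)) x\<bar> \<le> b k * card (edge_boundary G S)" for k
  proof -
    have "\<bar>\<Sum>x\<in>S. laplacian G (v (Suc k)) x\<bar> \<le>
        (\<Sum>(x, y)\<in>edge_boundary G S. \<bar>v (Suc k) y - v (Suc k) x\<bar>)"
      unfolding sum_laplacian_eq_flux[OF S] split_def by (rule sum_abs)
    also have "\<dots> \<le> (\<Sum>_\<in>edge_boundary G S. b k)"
      by (rule sum_mono) (auto simp: edge_boundary_def intro: lip)
    finally show ?thesis
      by (simp add: mult.commute)
  qed
  have "(\<Sum>x\<in>pverts G. \<bar>?f x - (resolvent ^^ N) ?f x\<bar>) =
      (\<Sum>x\<in>pverts G. ?f x * g x) - (\<Sum>x\<in>pverts G. (resolvent ^^ N) ?f x * g x)"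
    unfolding sum_subtractf[symmetric]
    by (rule sum.cong) (auto simp: g_def abs_sgn algebra_simps)
  also have "\<dots> = (\<Sum>x\<in>pverts G. ?f x * (v 0 x - v N x))"
    unfolding resolvent_iterate_symmetric[symmetric]
    by (simp add: v_def right_diff_distrib sum_subtractf)
  also have "\<dots> = (\<Sum>x\<in>S. v 0 x - v N x)"
    using S pair_finite_verts by (simp add: indicator_def if_distrib sum.If_cases Int_absorb1 cong: if_cong)
  also have "\<dots> = (\<Sum>x\<in>S. \<Sum>k<N. - laplacian G (v (Suc k)) x / D)"
  proof (rule sum.cong)
    fix x assume "x \<in> S"
    then have "x \<in> pverts G"
      using S by auto
    then have "v k x - v (Suc k) x = - laplacian G (v (Suc k)) x / D" for k
      using resolvent_equation[of x "v k"] by (simp add: v_def)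
    then show "v 0 x - v N x = (\<Sum>k<N. - laplacian G (v (Suc k)) x / D)"
      using sum_lessThan_telescope'[of "\<lambda>k. v k x" N] by simp
  qed simp
  also have "\<dots> = (\<Sum>k<N. - (\<Sum>x\<in>S. laplacian G (v (Suc k)) x) / D)"
    by (subst sum.swap) (simp add: sum_divide_distrib sum_negf)
  also have "\<dots> \<le> (\<Sum>k<N. b k * card (edge_boundary G S) / D)"
    using flux D_pos by (intro sum_mono divide_right_mono) (auto simp: abs_le_iff)
  also have "\<dots> = (\<Sum>k<N. b k) / D * card (edge_boundary G S)"
    by (simp add: sum_distrib_right sum_divide_distrib)
  also have "\<dots> \<le> (2 + 2 * sqrt n) * card (edge_boundary G S)"
  proof (rule mult_right_mono)
    have "(\<Sum>k<N. b k) = 2 + sqrt D * (\<Sum>k=1..n. 1 / sqrt k)"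
      unfolding N_def lessThan_Suc_atMost atMost_atLeast0 sum.atLeast_Suc_atMost[OF le0]
      by (simp add: b_def sum_distrib_left)
    also have "\<dots> \<le> 2 + sqrt D * (2 * sqrt n)"
      using sum_inverse_sqrt_le[of n] D_pos by (intro add_left_mono mult_left_mono) auto
    also have "\<dots> \<le> D * 2 + D * (2 * sqrt n)"
    proof (intro add_mono mult_right_mono)
      show "sqrt D \<le> D"
        using D_ge_1 real_sqrt_le_mono[of D "D * D"] by (simp add: real_sqrt_mult)
    qed (use D_ge_1 in auto)
    finally show "(\<Sum>k<N. b k) / D \<le> 2 + 2 * sqrt n"
      using D_pos by (simp add: divide_le_eq algebra_simps)
  qed simp
  finally show ?thesis
    by (simp add: N_def)
qed

text \<open>
  The number \<open>n\<close> of smoothing steps must satisfy \<open>sqrt (D / n) \<le> 50 D h\<close> for the Lipschitz bound and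
  \<open>(2 + 2 sqrt n) h \<le> 1 / 8\<close> for the \<open>L\<^sup>1\<close> bound. The choice \<open>sqrt n\<close> about \<open>1 / (50 h)\<close> meets the
  first; for the second, rounding up costs at most a multiple of \<open>h\<close>, which is absorbed for \<open>h \<le> 1 / 64\<close>.
\<close>

lemma smoothed_cut:
  fixes h :: real
  assumes CD: "CD_0_infinity G" and S: "S \<subseteq> pverts G"
    and h: "0 < h" "h \<le> 1 / 64" "card (edge_boundary G S) \<le> h * card S"
  obtains f :: "'a \<Rightarrow> real"
  where "\<forall>x y. (x, y) \<in> parcs G \<longrightarrow> \<bar>f y - f x\<bar> \<le> 50 * D * h"
    and "(\<Sum>x\<in>pverts G. \<bar>indicator S x - f x\<bar>) \<le> card S / 8"
proof -
  define t where "t = 1 / (50 * h)"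
  define n where "n = nat \<lceil>t\<^sup>2\<rceil>"
  define f where "f = (resolvent ^^ Suc n) (indicator S :: 'a \<Rightarrow> real)"
  have t: "0 < t"
    using h by (simp add: t_def)
  have n: "t\<^sup>2 \<le> n" "n \<le> t\<^sup>2 + 1"
    unfolding n_def using of_nat_ceiling[of "t\<^sup>2"] of_int_ceiling_le_add_one[of "t\<^sup>2"] by simp_all
  have "0 < n"
    using n(1) t by (metis gr0I not_le of_nat_0 zero_less_power)
  have "\<bar>f y - f x\<bar> \<le> 50 * D * h" if "(x, y) \<in> parcs G" for x y
  proof -
    have "\<bar>f y - f x\<bar> \<le> sqrt (D / n)"
      unfolding f_def
      by (rule resolvent_iterate_lipschitz[OF CD _ \<open>0 < n\<close> that]) (simp add: indicator_def)
    also have "\<dots> \<le> sqrt (D\<^sup>2 / t\<^sup>2)"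
      using n(1) t D_ge_1 by (intro real_sqrt_le_mono frac_le) (auto simp: power2_eq_square)
    also have "\<dots> = 50 * D * h"
      using t D_pos by (simp add: real_sqrt_divide) (simp add: t_def)
    finally show ?thesis .
  qed
  moreover have "(\<Sum>x\<in>pverts G. \<bar>indicator S x - f x\<bar>) \<le> card S / 8"
  proof -
    have "sqrt n \<le> t + 1"
      using n(2) t by (intro real_le_lsqrt) (auto simp: power2_eq_square algebra_simps)
    then have "(2 + 2 * sqrt n) * h \<le> (4 + 2 * t) * h"
      using h by (intro mult_right_mono) auto
    also have "\<dots> = 4 * h + 1 / 25"
      using h by (simp add: t_def field_simps)
    also have "\<dots> \<le> 1 / 8"
      using h by simp
    finally have "(2 + 2 * sqrt n) * h * card S \<le> 1 / 8 * card S"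
      by (rule mult_right_mono) simp
    moreover have "(2 + 2 * sqrt n) * card (edge_boundary G S) \<le> (2 + 2 * sqrt n) * (h * card S)"
      using h(3) by (intro mult_left_mono) auto
    ultimately show ?thesis
      using resolvent_iterate_L1_distance[OF CD S, of n] by (simp add: f_def algebra_simps)
  qed
  ultimately show ?thesis
    by (intro that) auto
qed

section \<open>Bands of level sets\<close>

lemma card_edge_boundary_le:
  assumes T: "finite T" and sub: "\<And>x y. (x, y) \<in> edge_boundary G S \<Longrightarrow> x \<in> T"
  shows "card (edge_boundary G S) \<le> D * card T"
proof -
  have "edge_boundary G S \<subseteq> Sigma T (\<lambda>x. {y. (x, y) \<in> parcs G})"
    using sub by (auto simp: edge_boundary_def)
  then have "card (edge_boundary G S) \<le> card (Sigma T (\<lambda>x. {y. (x, y) \<in> parcs G}))"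
    using T by (intro card_mono) auto
  also have "\<dots> = (\<Sum>x\<in>T. card {y. (x, y) \<in> parcs G})"
    using T by simp
  finally have "real (card (edge_boundary G S)) \<le> (\<Sum>x\<in>T. real (card {y. (x, y) \<in> parcs G}))"
    by (metis of_nat_le_iff of_nat_sum)
  also have "\<dots> \<le> D * card T"
    using sum_bounded_above[of T "\<lambda>x. real (card {y. (x, y) \<in> parcs G})" D] degree_le
    by (simp add: mult.commute)
  finally show ?thesis .
qed

definition level :: "('a \<Rightarrow> real) \<Rightarrow> real \<Rightarrow> 'a set" where
  "level f s = {x \<in> pverts G. s \<le> f x}"

definition band :: "('a \<Rightarrow> real) \<Rightarrow> real \<Rightarrow> real \<Rightarrow> 'a set" where
  "band f a b = {x \<in> pverts G. a \<le> f x \<and> f x < b}"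

lemma finite_band [simp]: "finite (band f a b)" and finite_level [simp]: "finite (level f s)"
  using pair_finite_verts by (auto simp: band_def level_def)

lemma band_mono: "a' \<le> a \<Longrightarrow> b \<le> b' \<Longrightarrow> band f a b \<subseteq> band f a' b'"
  by (auto simp: band_def)

lemma card_band_split:
  assumes "a \<le> s" "s \<le> b"
  shows "card (band f a b) = card (band f a s) + card (band f s b)"
proof -
  have "band f a b = band f a s \<union> band f s b" "band f a s \<inter> band f s b = {}"
    using assms by (auto simp: band_def)
  then show ?thesis
    by (simp add: card_Un_disjoint)
qed

text \<open>
  An edge leaving a superlevel set or a band must start within one Lipschitz step of its end.
\<close>

lemma level_boundary_le_band:
  assumes lip: "\<And>x y. (x, y) \<in> parcs G \<Longrightarrow> \<bar>f y - f x\<bar> \<le> L"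
  shows "card (edge_boundary G (level f s)) \<le> D * card (band f s (s + L))"
  using lip by (intro card_edge_boundary_le) (force simp: edge_boundary_def level_def band_def)+

lemma band_boundary_le_collar:
  assumes lip: "\<And>x y. (x, y) \<in> parcs G \<Longrightarrow> \<bar>f y - f x\<bar> \<le> L"
  shows "card (edge_boundary G (band f a b)) \<le> D * card (band f a b - band f (a + L) (b - L))"
  using lip by (intro card_edge_boundary_le) (force simp: edge_boundary_def band_def)+

text \<open>
  The heights \<open>a, a + L, a + 2 L, \<dots>\<close> divide the band into slices of width \<open>L\<close>, and each slice has to
  contain the sources of all boundary edges of the superlevel set at its bottom.
\<close>

lemma band_card_ge:
  fixes H :: real
  assumes lip: "\<And>x y. (x, y) \<in> parcs G \<Longrightarrow> \<bar>f y - f x\<bar> \<le> L" and L: "0 \<le> L"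
    and H: "\<And>s. a \<le> s \<Longrightarrow> s \<le> a + real J * L \<Longrightarrow> H \<le> card (edge_boundary G (level f s))"
  shows "real J * H \<le> D * card (band f a (a + real J * L))"
  using H
proof (induction J)
  case (Suc J)
  let ?s = "a + real J * L"
  have step: "?s \<le> a + real (Suc J) * L" "a \<le> ?s"
    using L by (simp_all add: mult_right_mono)
  have "real J * H \<le> D * card (band f a ?s)"
    using step by (intro Suc) auto
  moreover have "H \<le> D * card (band f ?s (?s + L))"
    using Suc.prems[OF step(2,1)] level_boundary_le_band[of f L ?s] lip by force
  moreover have "card (band f a (?s + L)) = card (band f a ?s) + card (band f ?s (?s + L))"
    using L step(2) by (intro card_band_split) auto
  moreover have "a + real (Suc J) * L = ?s + L"
    by (simp add: algebra_simps)
  ultimately show ?case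
    by (simp add: algebra_simps)
qed (use D_pos in simp)

text \<open>
  The boundary edges of each band in the shrinking family start in the collar removed in the next
  step. These collars are disjoint subsets of the first band, so one of \<open>J\<close> of them is small.
\<close>

lemma sparse_nested_band:
  assumes lip: "\<And>x y. (x, y) \<in> parcs G \<Longrightarrow> \<bar>f y - f x\<bar> \<le> L" and L: "0 \<le> L" and J: "0 < J"
  obtains j where "j < J"
    "real J * card (edge_boundary G (band f (a + real j * L) (b - real j * L))) \<le> D * card (band f a b)"
proof -
  define B where "B j = band f (a + real j * L) (b - real j * L)" for j
  define M where "M = D * card (band f a b) / real J"
  have collar: "card (edge_boundary G (B j)) \<le> D * (real (card (B j)) - real (card (B (Suc j))))" for j
  proof -
    have "B (Suc j) \<subseteq> B j"
      unfolding B_def using L by (intro band_mono) (auto simp: mult_right_mono)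
    then have "real (card (B j - B (Suc j))) = real (card (B j)) - real (card (B (Suc j)))"
      using finite_band by (simp add: B_def card_Diff_subset card_mono of_nat_diff)
    moreover have "B (Suc j) = band f ((a + real j * L) + L) ((b - real j * L) - L)"
      by (simp add: B_def algebra_simps)
    ultimately show ?thesis
      using band_boundary_le_collar[of f L "a + real j * L" "b - real j * L"] lip
      by (simp add: B_def)
  qed
  have "\<exists>j<J. card (edge_boundary G (B j)) \<le> M"
  proof (rule ccontr)
    assume "\<not> ?thesis"
    then have "(\<Sum>j<J. M) < (\<Sum>j<J. real (card (edge_boundary G (B j))))"
      using J by (intro sum_strict_mono) (auto simp: not_le)
    also have "\<dots> \<le> (\<Sum>j<J. D * (real (card (B j)) - real (card (B (Suc j)))))"
      by (intro sum_mono collar)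
    also have "\<dots> = D * (real (card (B 0)) - real (card (B J)))"
      unfolding sum_distrib_left[symmetric]
      using sum_lessThan_telescope'[of "\<lambda>j. real (card (B j))" J] by simp
    also have "\<dots> \<le> D * card (band f a b)"
      using D_pos by (intro mult_left_mono) (auto simp: B_def)
    finally show False
      using J by (simp add: M_def)
  qed
  then show ?thesis
    using that J by (auto simp: M_def B_def le_divide_eq mult.commute)
qed

text \<open>
  On the symmetric difference of \<open>S\<close> and the superlevel set, \<open>f\<close> is at distance at least \<open>1 / 4\<close> from the
  indicator of \<open>S\<close>, so by the \<open>L\<^sup>1\<close> bound it has at most \<open>|S| / 2\<close> elements.
\<close>

lemma level_near_set:
  assumes S: "S \<subseteq> pverts G"
    and L1: "(\<Sum>x\<in>pverts G. \<bar>indicator S x - f x\<bar>) \<le> card S / 8"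
    and s: "1 / 4 \<le> s" "s \<le> 3 / 4"
  shows "card S / 2 \<le> card (level f s)" "card (level f s) \<le> 3 / 2 * card S"
proof -
  let ?\<Delta> = "(S - level f s) \<union> (level f s - S)"
  have fin: "finite S"
    using S pair_finite_verts finite_subset by blast
  have "real (card ?\<Delta>) = (\<Sum>x\<in>?\<Delta>. 1)"
    by simp
  also have "\<dots> \<le> (\<Sum>x\<in>?\<Delta>. 4 * \<bar>indicator S x - f x\<bar>)"
    using s S by (intro sum_mono) (auto simp: level_def indicator_def)
  also have "\<dots> \<le> (\<Sum>x\<in>pverts G. 4 * \<bar>indicator S x - f x\<bar>)"
    using S pair_finite_verts by (intro sum_mono2) (auto simp: level_def)
  also have "\<dots> \<le> card S / 2"
    using L1 by (simp add: sum_distrib_left[symmetric])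
  finally have \<Delta>: "real (card ?\<Delta>) \<le> card S / 2" .
  have "card S \<le> card (level f s \<union> ?\<Delta>)" "card (level f s) \<le> card (S \<union> ?\<Delta>)"
    using fin by (auto intro!: card_mono)
  then have "card S \<le> card (level f s) + card ?\<Delta>" "card (level f s) \<le> card S + card ?\<Delta>"
    using card_Un_le[of "level f s" ?\<Delta>] card_Un_le[of S ?\<Delta>] by linarith+
  with \<Delta> show "card S / 2 \<le> card (level f s)" "card (level f s) \<le> 3 / 2 * card S"
    by linarith+
qed

section \<open>Comparing isoperimetric constants\<close>

text \<open>
  The heights \<open>a 0, \<dots>, a l\<close> in \<open>[1/4, 3/4]\<close> delimit bands of width \<open>3 J L\<close>. In each of them a
  concentric band \<open>B i\<close> with sparse boundary is found among those containing the middle third, so that the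
  lower bound for the size of the middle third applies to \<open>B i\<close>. The number \<open>J\<close>, which is of order
  \<open>1 / (l L)\<close>, is the largest for which the bands fit. The smallness assumption on \<open>h\<close> says \<open>6 l L \<le> 1\<close>,
  which makes \<open>J\<close> positive.
\<close>

lemma multiway_le_two_way:
  fixes h :: real
  assumes CD: "CD_0_infinity G" and conn: "Digraph_Component.connected (with_proj G)"
    and l: "2 \<le> l" and h: "multiway_isoperimetric 2 G = ereal h"
    and small: "h \<le> 1 / (300 * real l * D)"
  shows "multiway_isoperimetric l G \<le> ereal (1080000 * (real l)\<^sup>2 * D ^ 4 * h)"
proof -
  obtain S where S: "S \<subseteq> pverts G" "S \<noteq> {}" "2 * card S \<le> card (pverts G)"
    "card (edge_boundary G S) \<le> h * card S"
    using two_way_optimal_cut[OF h] .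
  have finS: "finite S"
    using S(1) pair_finite_verts finite_subset by blast
  then have cardS: "0 < real (card S)"
    using S(2) by (simp add: card_gt_0_iff)
  have "S \<noteq> pverts G"
    using S(3) cardS by auto
  then have "0 < card (edge_boundary G S)"
    using edge_boundary_nonempty[OF conn S(1,2)] by (simp add: card_gt_0_iff)
  then have "0 < h * card S"
    using S(4) by linarith
  then have h_pos: "0 < h"
    using cardS by (simp add: zero_less_mult_iff)
  have lD: "2 \<le> real l * D"
    using l D_ge_1 mult_mono[of 2 "real l" 1 D] by simp
  have h64: "h \<le> 1 / 64"
  proof -
    have "h \<le> 1 / (300 * real l * D)" by (rule small)
    also have "\<dots> \<le> 1 / 64"
      using lD by (intro frac_le) linarith+
    finally show ?thesis .
  qed
  obtain f :: "'a \<Rightarrow> real" where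
    "\<forall>x y. (x, y) \<in> parcs G \<longrightarrow> \<bar>f y - f x\<bar> \<le> 50 * D * h" and
    L1: "(\<Sum>x\<in>pverts G. \<bar>indicator S x - f x\<bar>) \<le> card S / 8"
    using smoothed_cut[OF CD S(1) h_pos h64 S(4)] .
  then have lip: "\<And>x y. (x, y) \<in> parcs G \<Longrightarrow> \<bar>f y - f x\<bar> \<le> 50 * D * h"
    by blast
  define L where "L = 50 * D * h"
  have L: "0 < L"
    using D_pos h_pos by (simp add: L_def)
  have lL: "6 * real l * L \<le> 1"
    using small lD by (simp add: L_def le_divide_eq algebra_simps)
  define q where "q = 1 / (6 * real l * L)"
  have "1 \<le> q"
    using lL L l by (simp add: q_def le_divide_eq)
  define J where "J = nat \<lfloor>q\<rfloor>"
  have "1 \<le> \<lfloor>q\<rfloor>"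
    using \<open>1 \<le> q\<close> by simp
  then have J: "0 < J" "real J \<le> q" "q / 2 \<le> real J"
    unfolding J_def by linarith+
  have J_upper: "6 * real l * (real J * L) \<le> 1"
    using J(2) L l by (simp add: q_def le_divide_eq algebra_simps)
  have J_lower: "1 / real J \<le> 12 * real l * L"
    using J L l by (simp add: q_def field_simps)

  have levels: "card S / 2 \<le> card (level f s)" "card (level f s) \<le> 3 / 2 * card S"
    "card S / 2 \<le> card (pverts G - level f s)" "h * card S / 2 \<le> card (edge_boundary G (level f s))"
    if s: "1 / 4 \<le> s" "s \<le> 3 / 4" for s
  proof -
    show 1: "card S / 2 \<le> card (level f s)" and 2: "card (level f s) \<le> 3 / 2 * card S"
      using level_near_set[OF S(1) L1 s] by auto
    have sub: "level f s \<subseteq> pverts G"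
      by (auto simp: level_def)
    have "real (card (pverts G - level f s)) = real (card (pverts G)) - real (card (level f s))"
      using pair_finite_verts sub by (simp add: card_Diff_subset card_mono of_nat_diff)
    then show 3: "card S / 2 \<le> card (pverts G - level f s)"
      using 2 S(3) by linarith
    show "h * card S / 2 \<le> card (edge_boundary G (level f s))"
      using isoperimetric_inequality[OF h _ sub 1 3] h_pos cardS by simp
  qed

  define a where "a i = 1 / 4 + 3 * real i * (real J * L)" for i :: nat
  have a_Suc: "a (Suc i) = a i + 3 * (real J * L)" for i
    by (simp add: a_def algebra_simps)
  have JL: "0 \<le> real J * L"
    using L by simp
  have a_mono: "a i \<le> a j" if "i \<le> j" for i j
    using that JL by (simp add: a_def mult_right_mono)
  have a_range: "1 / 4 \<le> a i" "i \<le> l \<Longrightarrow> a i \<le> 3 / 4" for i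
  proof -
    show "1 / 4 \<le> a i"
      using JL by (simp add: a_def)
    show "a i \<le> 3 / 4" if "i \<le> l"
    proof -
      have "a i \<le> a l"
        using that by (rule a_mono)
      also have "a l \<le> 3 / 4"
        using J_upper unfolding a_def by linarith
      finally show ?thesis .
    qed
  qed
  have "\<exists>j<J. real J * card (edge_boundary G (band f (a i + real j * L) (a (Suc i) - real j * L)))
      \<le> D * card (band f (a i) (a (Suc i)))" for i
    using sparse_nested_band[of f L J "a i" "a (Suc i)"] lip L J(1) unfolding L_def by (metis less_imp_le)
  then obtain j where j: "j i < J"
    "real J * card (edge_boundary G (band f (a i + real (j i) * L) (a (Suc i) - real (j i) * L)))
      \<le> D * card (band f (a i) (a (Suc i)))" for i
    by metis
  define B where "B i = band f (a i + real (j i) * L) (a (Suc i) - real (j i) * L)" for i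
  have B_sub: "B i \<subseteq> band f (a i) (a (Suc i))" for i
    unfolding B_def using L by (intro band_mono) auto
  have band_sub: "band f (a i) (a (Suc i)) \<subseteq> level f (1 / 4)" for i
    using a_range(1)[of i] by (auto simp: band_def level_def)
  have B_boundary: "card (edge_boundary G (B i)) \<le> 3 / 2 * D * card S / J" for i
  proof -
    have "real (card (band f (a i) (a (Suc i)))) \<le> card (level f (1 / 4))"
      using card_mono[OF _ band_sub[of i]] by simp
    also have "\<dots> \<le> 3 / 2 * card S"
      using levels(2)[of "1 / 4"] by simp
    finally have "D * card (band f (a i) (a (Suc i))) \<le> D * (3 / 2 * card S)"
      using D_pos by (intro mult_left_mono) auto
    then have "real J * card (edge_boundary G (B i)) \<le> D * (3 / 2 * card S)"
      using j(2)[of i] by (simp add: B_def)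
    then show ?thesis
      using J(1) by (simp add: le_divide_eq algebra_simps)
  qed
  have B_card: "real J * (h * card S / 2) / D \<le> card (B i)" if i: "i < l - 1" for i
  proof -
    let ?b = "a i + real J * L"
    have "?b + real J * L \<le> a (Suc i)" "a (Suc i) \<le> 3 / 4" "1 / 4 \<le> ?b"
      using JL a_range(1)[of i] a_range(2)[of "Suc i"] a_Suc[of i] i by linarith+
    then have "real J * (h * card S / 2) \<le> D * card (band f ?b (?b + real J * L))"
      using L lip by (intro band_card_ge levels(4)) (auto simp: L_def)
    moreover have "band f ?b (?b + real J * L) \<subseteq> B i"
    proof -
      have "real (j i) * L \<le> real J * L"
        using j(1)[of i] L by (intro mult_right_mono) auto
      then show ?thesis
        unfolding B_def a_Suc by (intro band_mono) linarith+
    qed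
    then have "D * real (card (band f ?b (?b + real J * L))) \<le> D * card (B i)"
      using D_pos by (intro mult_left_mono) (auto simp: B_def intro!: card_mono)
    ultimately have "real J * (h * card S / 2) \<le> D * card (B i)"
      by linarith
    then show ?thesis
      using D_pos by (simp only: divide_le_eq mult.commute if_True)
  qed
  have B_lower_pos: "0 < real J * (h * card S / 2) / D"
    using J(1) h_pos cardS D_pos by simp
  have B_nonempty: "B i \<noteq> {}" if "i < l - 1" for i
    using B_card[OF that] B_lower_pos by auto
  have B_disjoint: "B i \<inter> B i' = {}" if "i \<noteq> i'" for i i'
  proof -
    have "Suc i \<le> i' \<or> Suc i' \<le> i"
      using that by linarith
    then have "a (Suc i) \<le> a i' \<or> a (Suc i') \<le> a i"
      using a_mono by blast
    then have "band f (a i) (a (Suc i)) \<inter> band f (a i') (a (Suc i')) = {}"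
      by (auto simp: band_def)
    then show ?thesis
      using B_sub by blast
  qed

  \<comment> \<open>The remaining vertices form the last part. It contains the sublevel set \<open>f < 1/4\<close>, hence is not
    small, and all of its boundary edges are shared with the bands.\<close>
  define R where "R = pverts G - (\<Union>i<l - 1. B i)"
  have R_card: "card S / 2 \<le> card R"
  proof -
    have "pverts G - level f (1 / 4) \<subseteq> R"
      using B_sub band_sub by (fastforce simp: R_def)
    then have "card (pverts G - level f (1 / 4)) \<le> card R"
      using pair_finite_verts by (intro card_mono) (auto simp: R_def)
    then show ?thesis
      using levels(3)[of "1 / 4"] by simp
  qed
  have R_boundary: "card (edge_boundary G R) \<le> l * (3 / 2 * D * card S / J)"
  proof -
    have "edge_boundary G R \<subseteq> prod.swap ` (\<Union>i<l - 1. edge_boundary G (B i))"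
    proof
      fix e assume "e \<in> edge_boundary G R"
      then obtain x y i where e: "e = (x, y)" "(x, y) \<in> parcs G" "x \<in> R" "i < l - 1" "y \<in> B i"
        by (auto simp: edge_boundary_def R_def)
      then have "(y, x) \<in> edge_boundary G (B i)"
        using arc_sym by (auto simp: edge_boundary_def R_def)
      then show "e \<in> prod.swap ` (\<Union>i<l - 1. edge_boundary G (B i))"
        using e by (force intro: image_eqI[where x = "(y, x)"])
    qed
    then have "card (edge_boundary G R) \<le> card (prod.swap ` (\<Union>i<l - 1. edge_boundary G (B i)))"
      by (intro card_mono) auto
    also have "\<dots> \<le> card (\<Union>i<l - 1. edge_boundary G (B i))"
      by (intro card_image_le) auto
    also have "\<dots> \<le> (\<Sum>i<l - 1. card (edge_boundary G (B i)))"
      by (intro card_UN_le) auto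
    finally have "real (card (edge_boundary G R)) \<le> (\<Sum>i<l - 1. real (card (edge_boundary G (B i))))"
      by (metis of_nat_le_iff of_nat_sum)
    also have "\<dots> \<le> real (l - 1) * (3 / 2 * D * card S / J)"
      using sum_bounded_above[of "{..<l - 1}" "\<lambda>i. real (card (edge_boundary G (B i)))", OF B_boundary]
      by (simp only: card_lessThan)
    also have "\<dots> \<le> l * (3 / 2 * D * card S / J)"
      using D_pos by (intro mult_right_mono) auto
    finally show ?thesis .
  qed

  let ?P = "insert R (B ` {..<l - 1})"
  have R_new: "R \<notin> B ` {..<l - 1}"
    using B_nonempty by (auto simp: R_def)
  have "R \<noteq> {}"
    using R_card cardS by auto
  have B_verts: "B i \<subseteq> pverts G" for i
    by (auto simp: B_def band_def)
  have P: "partition_on (pverts G) ?P"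
  proof (rule partition_onI)
    show "\<Union> ?P = pverts G"
      using B_verts by (auto simp: R_def)
    show "{} \<notin> ?P"
      using B_nonempty \<open>R \<noteq> {}\<close> by auto
    have R_B: "disjnt R (B i)" if "i < l - 1" for i
      using that by (auto simp: R_def disjnt_def)
    show "disjnt p q" if pq: "p \<in> ?P" "q \<in> ?P" "p \<noteq> q" for p q
    proof -
      consider "p = R" "q \<in> B ` {..<l - 1}" | "q = R" "p \<in> B ` {..<l - 1}"
        | "p \<in> B ` {..<l - 1}" "q \<in> B ` {..<l - 1}"
        using pq by blast
      then show ?thesis
      proof cases
        case 1
        then show ?thesis using R_B by blast
      next
        case 2
        then show ?thesis using R_B disjnt_sym by blast
      next
        case 3
        then obtain i i' where i: "p = B i" "q = B i'"
          by blast
        then have "i \<noteq> i'"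
          using pq(3) by blast
        then show ?thesis
          using B_disjoint i by (simp add: disjnt_def)
      qed
    qed
  qed
  have "inj_on B {..<l - 1}"
    using B_disjoint B_nonempty by (intro inj_onI) (metis Int_absorb lessThan_iff)
  then have "card ?P = l"
    using R_new l by (simp add: card_image)
  moreover have "expansion G T \<le> 1080000 * (real l)\<^sup>2 * D ^ 4 * h" if T: "T \<in> ?P" for T
  proof (cases "T = R")
    case True
    have "expansion G R \<le> l * (3 / 2 * D * card S / J) / (card S / 2)"
      unfolding expansion_def using R_boundary R_card cardS by (intro frac_le) auto
    also have "\<dots> = 3 * real l * D * (1 / J)"
      using cardS by simp
    also have "\<dots> \<le> 3 * real l * D * (12 * real l * L)"
      using J_lower D_pos by (intro mult_left_mono) auto
    also have "\<dots> = 1800 * (real l)\<^sup>2 * D ^ 2 * h"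
      by (simp add: L_def power2_eq_square)
    also have "\<dots> \<le> 1080000 * (real l)\<^sup>2 * D ^ 4 * h"
      using D_ge_1 h_pos by (intro mult_right_mono mult_mono power_increasing) auto
    finally show ?thesis
      using True by simp
  next
    case False
    then obtain i where i: "i < l - 1" "T = B i"
      using T by blast
    have "expansion G (B i) \<le> (3 / 2 * D * card S / J) / (real J * (h * card S / 2) / D)"
      unfolding expansion_def using B_boundary[of i] B_card[OF i(1)] B_lower_pos
      by (intro frac_le) auto
    also have "\<dots> = 3 * D\<^sup>2 / h * (1 / J)\<^sup>2"
      using cardS h_pos J(1) by (simp add: power2_eq_square)
    also have "\<dots> \<le> 3 * D\<^sup>2 / h * (12 * real l * L)\<^sup>2"
      using J_lower D_pos h_pos by (intro mult_left_mono power_mono) auto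
    also have "\<dots> = 1080000 * (real l)\<^sup>2 * D ^ 4 * h"
      using h_pos by (simp add: L_def power2_eq_square power4_eq_xxxx)
    finally show ?thesis
      using i by simp
  qed
  ultimately show ?thesis
    using P by (intro multiway_isoperimetric_le[of ?P]) auto
qed

end

section \<open>Equivalence of the expander properties\<close>

lemma bounded_degree_graphI:
  assumes "pair_graph G" and deg: "max_degree G \<le> d"
  shows "bounded_degree_graph G (max 1 (real d))"
proof -
  interpret pair_graph G by fact
  have "card {y. (x, y) \<in> parcs G} \<le> d" for x
  proof (cases "x \<in> pverts G")
    case True
    have "card {y. (x, y) \<in> parcs G} = card (out_arcs (with_proj G) x)"
      by (rule bij_betw_same_card[where f = "\<lambda>y. (x, y)"]) (auto simp: bij_betw_def inj_on_def out_arcs_def)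
    also have "\<dots> = out_degree (with_proj G) x"
      by (simp add: out_degree_def)
    also have "\<dots> \<le> max_degree G"
      unfolding max_degree_def using True pair_finite_verts by (intro Max_ge) auto
    finally show ?thesis
      using deg by simp
  next
    case False
    then have "{y. (x, y) \<in> parcs G} = {}"
      by (auto dest: in_arcsD1)
    then show ?thesis by simp
  qed
  then show ?thesis
    by unfold_locales (auto intro: le_max_iff_disj[THEN iffD2])
qed

text \<open>
  If some \<open>h\<^sub>2\<close> were below \<open>\<eta>\<close>, the comparison \<open>h\<^sub>l \<le> C h\<^sub>2\<close>, whose constant is uniform along the
  sequence, would force \<open>h\<^sub>l\<close> below its positive lower bound \<open>c\<close>.
\<close>

lemma two_way_expanders_if_multiway_expanders:
  fixes G :: "nat \<Rightarrow> 'a pair_pre_digraph"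
  assumes graph: "\<And>m. pair_graph (G m)"
    and conn: "\<And>m. Digraph_Component.connected (with_proj (G m))"
    and CD: "\<And>m. CD_0_infinity (G m)"
    and l: "2 \<le> l" and exp: "multiway_expanders l G"
  shows "multiway_expanders 2 G"
proof -
  have deg: "(SUP m. enat (max_degree (G m))) < \<infinity>"
    and size: "filterlim (\<lambda>m. card (pverts (G m))) at_top sequentially"
    and gap: "(INF m. multiway_isoperimetric l (G m)) > 0"
    using exp by (auto simp: multiway_expanders_def)
  obtain d where d: "(SUP m. enat (max_degree (G m))) = enat d"
    using deg by auto
  have "enat (max_degree (G m)) \<le> enat d" for m
    unfolding d[symmetric] by (rule SUP_upper) simp
  then have deg_le: "max_degree (G m) \<le> d" for m
    by simp
  define D where "D = max 1 (real d)"
  have D: "1 \<le> D"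
    by (simp add: D_def)
  obtain c where c: "0 < ereal c" "ereal c < (INF m. multiway_isoperimetric l (G m))"
    using ereal_dense2[OF gap] by auto
  define C where "C = 1080000 * (real l)\<^sup>2 * D ^ 4"
  have C: "0 < C"
    using D l by (simp add: C_def)
  define \<eta> where "\<eta> = min (1 / (300 * real l * D)) (c / C)"
  have "0 < \<eta>"
    using c(1) C D l by (simp add: \<eta>_def)
  have "ereal \<eta> \<le> multiway_isoperimetric 2 (G m)" for m
  proof (rule ccontr)
    interpret bounded_degree_graph "G m" D
      unfolding D_def by (rule bounded_degree_graphI[OF graph deg_le])
    assume "\<not> ?thesis"
    then obtain h where h: "multiway_isoperimetric 2 (G m) = ereal h" "h < \<eta>"
      by (auto simp: multiway_isoperimetric_def not_le split: if_splits)
    then have "multiway_isoperimetric l (G m) \<le> ereal (C * h)"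
      unfolding C_def by (intro multiway_le_two_way CD conn l) (auto simp: \<eta>_def)
    moreover have "C * h < c"
      using h(2) C by (simp add: \<eta>_def less_divide_eq mult.commute)
    moreover have "ereal c < multiway_isoperimetric l (G m)"
      using c(2) by (rule less_le_trans) (auto intro: INF_lower)
    ultimately have "ereal c < ereal c"
      by (metis ereal_less_eq(3) less_imp_le less_le_trans order_trans)
    then show False by simp
  qed
  then have "ereal \<eta> \<le> (INF m. multiway_isoperimetric 2 (G m))"
    by (intro INF_greatest)
  then have "(INF m. multiway_isoperimetric 2 (G m)) > 0"
    using \<open>0 < \<eta>\<close> by (metis ereal_less(2) less_le_trans)
  then show ?thesis
    using deg size by (simp add: multiway_expanders_def)
qed

lemma multiway_expanders_if_two_way_expanders:
  assumes graph: "\<And>m. pair_graph (G m)" and l: "2 \<le> l" and exp: "multiway_expanders 2 G"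
  shows "multiway_expanders l G"
proof -
  have "(INF m. multiway_isoperimetric 2 (G m)) \<le> (INF m. multiway_isoperimetric l (G m))"
    using pair_graph.two_way_le_multiway[OF graph l] by (intro INF_mono) auto
  then show ?thesis
    using exp by (auto simp: multiway_expanders_def)
qed

theorem corollary4p6:
  fixes G :: "nat \<Rightarrow> 'a pair_pre_digraph" and k l :: nat
  assumes "\<And>m. pair_graph (G m)"
    and "\<And>m. Digraph_Component.connected (with_proj (G m))"
    and "\<And>m. CD_0_infinity (G m)"
    and "k \<ge> 2" and "l \<ge> 2"
  shows "multiway_expanders k G \<longleftrightarrow> multiway_expanders l G"
proof
  assume "multiway_expanders k G"
  then have "multiway_expanders 2 G"
    by (rule two_way_expanders_if_multiway_expanders[OF assms(1-4)])
  then show "multiway_expanders l G"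
    by (rule multiway_expanders_if_two_way_expanders[OF assms(1,5)])
next
  assume "multiway_expanders l G"
  then have "multiway_expanders 2 G"
    by (rule two_way_expanders_if_multiway_expanders[OF assms(1-3,5)])
  then show "multiway_expanders k G"
    by (rule multiway_expanders_if_two_way_expanders[OF assms(1,4)])
qed

end
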